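(* Let $\mathbb{1}$ be the $d\times d$ identity matrix and let $W$ be the $d\times d$ van der Waerden matrix, $W_{kl}=1/d$ for all $k,l$. Then the distinguishability numbers are $\mathcal{M}(\mathbb{1})=d$ and $\mathcal{M}(W)=d^2$.
   Context: Fix an orthonormal basis $\{|k\rangle\}_{k=1}^d$ of $\mathbb{C}^d$. A quantum channel is a completely positive trace-preserving linear map $\Phi$ on $d\times d$ complex matrices. Its classical action is the (column-)stochastic matrix $T$ with $T_{kl}=\langle k|\Phi(|l\rangle\langle l|)|k\rangle$. A set of channels $\{\Phi^{(n)}\}_{n=1}^M$ is perfectly distinguishable if there is a (possibly entangled) pure bipartite state $|\Psi\rangle\in\mathbb{C}^d\otimes\mathbb{C}^d$ such that the output states $(\Phi^{(n)}\otimes\mathcal{I})(|\Psi\rangle\langle\Psi|)$, $n=1,\dots,M$, have pairwise orthogonal supports, where $\mathcal{I}$ is the identity channel. The distinguishability number $\mathcal{M}(T)$ of a stochastic matrix $T$ is the maximal number of quantum channels that all have classical action $T$ and that are perfectly distinguishable. *)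

theory Defs
  imports "HOL-Analysis.Analysis" "HOL-Library.Extended_Nat"
begin

text \<open>
  The dimension \<open>d\<close> is \<open>CARD('n)\<close>; \<open>complex^'n\<close> is \<open>d\<close>-dimensional complex space and
  \<open>complex^('n \<times> 'm)\<close> is the tensor product of \<open>complex^'n\<close> and \<open>complex^'m\<close>.
\<close>

text \<open>Conjugate-linear in the first argument (the library's \<open>inner\<close> on \<open>complex^'n\<close> is real-valued).\<close>

definition cinner :: "complex^'n \<Rightarrow> complex^'n \<Rightarrow> complex" where
  "cinner u v = (\<Sum>i\<in>UNIV. cnj (u $ i) * v $ i)"

text \<open>The operator \<open>|u\<rangle>\<langle>v|\<close>.\<close>

definition ketbra :: "complex^'n \<Rightarrow> complex^'m \<Rightarrow> complex^'m^'n" where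
  "ketbra u v = (\<chi> i j. u $ i * cnj (v $ j))"

text \<open>
  \<open>CARD('n)\<close> orthonormal vectors of \<open>complex^'n\<close> automatically span, so orthonormality alone
  characterises an orthonormal basis indexed by \<open>'n\<close>.
\<close>

definition orthonormal_basis :: "('n::finite \<Rightarrow> complex^'n) \<Rightarrow> bool" where
  "orthonormal_basis e \<longleftrightarrow> (\<forall>k l. cinner (e k) (e l) = (if k = l then 1 else 0))"

text \<open>
  Entrywise scaling by a complex number; \<open>*s\<close> on \<open>complex^'n^'n\<close> would take scalars from
  \<open>complex^'n\<close> instead.
\<close>

definition mscale :: "complex \<Rightarrow> complex^'n^'m \<Rightarrow> complex^'n^'m" where
  "mscale c A = (\<chi> i j. c * A $ i $ j)"

text \<open>
  A \<open>k \<times> k\<close> block matrix with blocks \<open>X a b\<close> (\<open>a, b < k\<close>) of size \<open>d \<times> d\<close>, i.e. the operator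
  \<open>\<Sum>a b. |a\<rangle>\<langle>b| \<otimes> X a b\<close>, is positive semidefinite.
\<close>

definition block_psd :: "nat \<Rightarrow> (nat \<Rightarrow> nat \<Rightarrow> complex^'n^'n) \<Rightarrow> bool" where
  "block_psd k X \<longleftrightarrow>
    (\<forall>v :: nat \<Rightarrow> complex^'n. (\<Sum>a<k. \<Sum>b<k. cinner (v a) (X a b *v v b)) \<in> \<real>\<^sub>\<ge>\<^sub>0)"

text \<open>
  The tensor product of the identity on \<open>k \<times> k\<close> matrices with \<open>\<Phi>\<close> applies \<open>\<Phi>\<close> to every block;
  it has to be positive for every \<open>k\<close>. The ancilla is indexed by \<open>{..<k}\<close> since one cannot
  quantify over an ancilla type here.
\<close>

definition completely_positive :: "(complex^'n^'n \<Rightarrow> complex^'n^'n) \<Rightarrow> bool" where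
  "completely_positive \<Phi> \<longleftrightarrow>
    (\<forall>k X. block_psd k X \<longrightarrow> block_psd k (\<lambda>a b. \<Phi> (X a b)))"

definition quantum_channel :: "(complex^'n^'n \<Rightarrow> complex^'n^'n) \<Rightarrow> bool" where
  "quantum_channel \<Phi> \<longleftrightarrow>
    Vector_Spaces.linear mscale mscale \<Phi> \<and> completely_positive \<Phi> \<and>
    (\<forall>X. trace (\<Phi> X) = trace X)"

definition has_classical_action ::
    "('n \<Rightarrow> complex^'n) \<Rightarrow> (complex^'n^'n \<Rightarrow> complex^'n^'n) \<Rightarrow> real^'n^'n \<Rightarrow> bool" where
  "has_classical_action e \<Phi> T \<longleftrightarrow>
    (\<forall>k l. complex_of_real (T $ k $ l) = cinner (e k) (\<Phi> (ketbra (e l) (e l)) *v e k))"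

text \<open>
  The map \<open>\<Phi> \<otimes> \<I>\<close>, i.e. the linear map sending \<open>A \<otimes> B\<close> to \<open>\<Phi> A \<otimes> B\<close>: for fixed ancilla
  indices \<open>a\<close>, \<open>b\<close>, the map \<open>\<Phi>\<close> acts on the block \<open>\<rho> (\<cdot>, a) (\<cdot>, b)\<close>.
\<close>

definition tensor_id ::
    "(complex^'n^'n \<Rightarrow> complex^'n^'n) \<Rightarrow>
      complex^('n \<times> 'm::finite)^('n \<times> 'm) \<Rightarrow> complex^('n \<times> 'm)^('n \<times> 'm)"
  where
  "tensor_id \<Phi> \<rho> =
    (\<chi> p q. \<Phi> (\<chi> i j. \<rho> $ (i, snd p) $ (j, snd q)) $ fst p $ fst q)"

text \<open>The support of an operator is the orthogonal complement of its kernel.\<close>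

definition op_support :: "complex^'k^'k \<Rightarrow> (complex^'k) set" where
  "op_support A = {v. \<forall>u. A *v u = 0 \<longrightarrow> cinner u v = 0}"

definition orthogonal_supports :: "complex^'k^'k \<Rightarrow> complex^'k^'k \<Rightarrow> bool" where
  "orthogonal_supports A B \<longleftrightarrow> (\<forall>u\<in>op_support A. \<forall>v\<in>op_support B. cinner u v = 0)"

definition perfectly_distinguishable ::
    "nat \<Rightarrow> (nat \<Rightarrow> complex^'n^'n \<Rightarrow> complex^'n^'n) \<Rightarrow> bool" where
  "perfectly_distinguishable M \<Phi> \<longleftrightarrow>
    (\<exists>\<psi> :: complex^('n \<times> 'n). norm \<psi> = 1 \<and>
      (\<forall>m\<in>{1..M}. \<forall>n\<in>{1..M}. m \<noteq> n \<longrightarrow>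
        orthogonal_supports (tensor_id (\<Phi> m) (ketbra \<psi> \<psi>)) (tensor_id (\<Phi> n) (ketbra \<psi> \<psi>))))"

text \<open>
  Taken as a supremum in \<open>enat\<close>, which is well defined without knowing boundedness in advance;
  a finite supremum of naturals is a maximum.
\<close>

definition distinguishability_number :: "('n \<Rightarrow> complex^'n) \<Rightarrow> real^'n^'n \<Rightarrow> enat" where
  "distinguishability_number e T =
    Sup {enat M | M. \<exists>\<Phi>. (\<forall>n\<in>{1..M}. quantum_channel (\<Phi> n) \<and> has_classical_action e (\<Phi> n) T) \<and>
                         perfectly_distinguishable M \<Phi>}"

definition van_der_waerden :: "real^'n^'n" where
  "van_der_waerden = (\<chi> k l. 1 / real CARD('n))"

end

theory Submission imports Defs begin

text \<open>
  The outputs of \<open>M\<close> distinguishable channels are nonzero Hermitian operators on \<open>d\<^sup>2\<close>-dimensional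
  space with orthogonal supports, so \<open>M \<le> d\<^sup>2\<close>. If the classical action is the identity, the diagonal
  entries of the Choi matrix at \<open>(i, k)\<close> with \<open>i \<noteq> k\<close> vanish, and by positivity so do their rows;
  hence all outputs for the input \<open>\<Sum>k. e k \<otimes> \<psi> k\<close> have range in the span of the \<open>d\<close> vectors
  \<open>e k \<otimes> \<psi> k\<close>, and \<open>M \<le> d\<close>. Conversely, unitary channels of pairwise Hilbert--Schmidt orthogonal
  unitaries are distinguished by the maximally entangled state. With \<open>\<omega> = exp (2\<pi>i/d)\<close>, the unitaries
  are \<open>diag (\<omega> ^ (m k))\<close> for the identity and \<open>(\<omega> ^ (a k + k l + b l) / \<surd>d)\<close> for the van der Waerden matrix.
\<close>

section \<open>Inner product, rank-one operators and adjoints\<close>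

lemma cinner_add_right: "cinner w (u + v) = cinner w u + cinner w v"
  by (simp add: cinner_def algebra_simps sum.distrib)

lemma cinner_scale_left: "cinner (c *s u) w = cnj c * cinner u w"
  by (simp add: cinner_def algebra_simps sum_distrib_left)

lemma cinner_scale_right: "cinner w (c *s u) = c * cinner w u"
  by (simp add: cinner_def algebra_simps sum_distrib_left)

lemma cinner_zero_right: "cinner w 0 = 0"
  by (simp add: cinner_def)

lemma cnj_cinner: "cnj (cinner u v) = cinner v u"
  by (simp add: cinner_def mult.commute)

lemma cinner_sum_right: "cinner w (\<Sum>i\<in>I. f i) = (\<Sum>i\<in>I. cinner w (f i))"
  by (induction I rule: infinite_finite_induct) (simp_all add: cinner_zero_right cinner_add_right)

lemma cinner_self: "cinner u u = of_real ((norm u)\<^sup>2)"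
  by (simp add: cinner_def norm_vec_def L2_set_def sum_nonneg complex_norm_square mult.commute
      del: of_real_power)

lemma cinner_self_eq_0: "cinner u u = 0 \<longleftrightarrow> u = 0"
  by (simp add: cinner_self)

lemma cinner_axis_left: "cinner (axis i 1) v = v $ i"
  by (simp add: cinner_def axis_def if_distrib[of cnj] if_distrib[of "\<lambda>x. x * _"] cong: if_cong)

lemma mult_vec_axis_nth: "(A *v axis j (1::complex)) $ i = A $ i $ j"
  by (simp add: matrix_vector_mult_def axis_def if_distrib[of "\<lambda>x. _ * x"] cong: if_cong)

lemma ketbra_mult_vec: "ketbra u v *v w = cinner v w *s u"
  by (simp add: ketbra_def cinner_def matrix_vector_mult_def vec_eq_iff sum_distrib_left
      sum_distrib_right mult.assoc mult.left_commute mult.commute)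

definition adjoint_mat :: "complex^'n^'m \<Rightarrow> complex^'m^'n" where
  "adjoint_mat A = (\<chi> i j. cnj (A $ j $ i))"

lemma adjoint_mat_nth [simp]: "adjoint_mat A $ i $ j = cnj (A $ j $ i)"
  by (simp add: adjoint_mat_def)

lemma adjoint_mat_adjoint_mat [simp]: "adjoint_mat (adjoint_mat A) = A"
  by (simp add: vec_eq_iff)

lemma adjoint_mat_mult: "adjoint_mat (A ** B) = adjoint_mat B ** adjoint_mat A"
  by (simp add: vec_eq_iff matrix_matrix_mult_def mult.commute)

lemma cinner_adjoint: "cinner u (A *v w) = cinner (adjoint_mat A *v u) w"
proof -
  have "cinner u (A *v w) = (\<Sum>i\<in>UNIV. \<Sum>j\<in>UNIV. cnj (u $ i) * A $ i $ j * w $ j)"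
    by (simp add: cinner_def matrix_vector_mult_def sum_distrib_left mult.assoc)
  also have "\<dots> = (\<Sum>j\<in>UNIV. \<Sum>i\<in>UNIV. cnj (u $ i) * A $ i $ j * w $ j)"
    by (rule sum.swap)
  also have "\<dots> = cinner (adjoint_mat A *v u) w"
    by (simp add: cinner_def matrix_vector_mult_def sum_distrib_left sum_distrib_right ac_simps)
  finally show ?thesis .
qed

section \<open>Completely positive maps\<close>

text \<open>That the values at \<open>t\<close> = 1, -1, i, -i are real determines
  \<open>\<gamma>\<close>. If \<open>\<alpha> = 0\<close>, the form is affine in \<open>t\<close>,
  and moving far enough in direction \<open>-\<beta>\<close> would make it negative.\<close>

lemma nonneg_quadratic_form:
  fixes \<alpha> \<beta> \<gamma> \<delta> :: complex
  assumes "\<And>t. cnj t * t * \<alpha> + cnj t * \<beta> + t * \<gamma> + \<delta> \<in> \<real>\<^sub>\<ge>\<^sub>0"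
  shows "\<gamma> = cnj \<beta>" and "\<alpha> = 0 \<Longrightarrow> \<beta> = 0"
proof -
  show \<gamma>: "\<gamma> = cnj \<beta>"
    using assms[of 1] assms[of "-1"] assms[of \<i>] assms[of "-\<i>"]
    by (simp add: complex_eq_iff complex_nonneg_Reals_iff)
  show "\<beta> = 0" if "\<alpha> = 0"
  proof (rule ccontr)
    assume "\<beta> \<noteq> 0"
    define q where "q = (Re \<beta>)\<^sup>2 + (Im \<beta>)\<^sup>2"
    have q: "q > 0"
      using \<open>\<beta> \<noteq> 0\<close> by (simp add: q_def complex_neq_0)
    \<comment> \<open>With \<open>t\<close> = -\<open>s * \<beta>\<close> the real part of the form
      is \<open>Re \<delta> - 2 * s * q\<close>; this \<open>s\<close> makes it equal to -1.\<close>
    define s where "s = (Re \<delta> + 1) / (2 * q)"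
    have "0 \<le> Re \<delta> - 2 * s * q"
      using assms[of "- of_real s * \<beta>"] that \<gamma>
      by (simp add: complex_nonneg_Reals_iff q_def power2_eq_square algebra_simps)
    also have "2 * s * q = Re \<delta> + 1"
      using q by (simp add: s_def)
    finally show False by simp
  qed
qed

text \<open>A two-dimensional ancilla suffices: the blocks |w a><w b| form the rank-one operator of
  the stacked vector (\<open>u\<close>, \<open>v\<close>), hence a positive one. Its image under the
  blockwise \<open>\<Phi>\<close> is tested against the stacked vector (\<open>p\<close>,
  \<open>q\<close>).\<close>

lemma completely_positive_two_blocks:
  assumes "completely_positive \<Phi>"
  shows "cinner p (\<Phi> (ketbra u u) *v p) + cinner p (\<Phi> (ketbra u v) *v q) +
         cinner q (\<Phi> (ketbra v u) *v p) + cinner q (\<Phi> (ketbra v v) *v q) \<in> \<real>\<^sub>\<ge>\<^sub>0"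
proof -
  define w where "w a = (if a = (0::nat) then u else v)" for a
  have "block_psd 2 (\<lambda>a b. ketbra (w a) (w b))"
    unfolding block_psd_def
  proof
    fix x :: "nat \<Rightarrow> complex^'a"
    define c where "c = cinner (w 0) (x 0) + cinner (w 1) (x 1)"
    have "(\<Sum>a<2. \<Sum>b<2. cinner (x a) (ketbra (w a) (w b) *v x b)) = c * cnj c"
      by (simp add: numeral_2_eq_2 c_def ketbra_mult_vec cinner_scale_right cnj_cinner algebra_simps)
    then show "(\<Sum>a<2. \<Sum>b<2. cinner (x a) (ketbra (w a) (w b) *v x b)) \<in> \<real>\<^sub>\<ge>\<^sub>0"
      by (simp add: complex_nonneg_Reals_iff)
  qed
  then have "block_psd 2 (\<lambda>a b. \<Phi> (ketbra (w a) (w b)))"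
    using assms by (auto simp: completely_positive_def)
  then show ?thesis
    unfolding block_psd_def
    by (drule_tac x="\<lambda>a. if a = 0 then p else q" in spec)
       (simp add: numeral_2_eq_2 w_def algebra_simps)
qed

text \<open>Replacing \<open>p\<close> by \<open>t *s p\<close> in the two-block inequality yields a
  quadratic form in \<open>t\<close>. The second conclusion is the operator version of the fact that
  a zero diagonal entry of a positive matrix forces its row to vanish.\<close>

lemma
  assumes "completely_positive \<Phi>"
  shows completely_positive_hermitian:
      "cinner q (\<Phi> (ketbra v u) *v p) = cnj (cinner p (\<Phi> (ketbra u v) *v q))"
    and completely_positive_null:
      "cinner p (\<Phi> (ketbra u u) *v p) = 0 \<Longrightarrow> cinner p (\<Phi> (ketbra u v) *v q) = 0"
proof -
  have "cnj t * t * cinner p (\<Phi> (ketbra u u) *v p) + cnj t * cinner p (\<Phi> (ketbra u v) *v q) +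
      t * cinner q (\<Phi> (ketbra v u) *v p) + cinner q (\<Phi> (ketbra v v) *v q) \<in> \<real>\<^sub>\<ge>\<^sub>0" for t
    using completely_positive_two_blocks[OF assms, of "t *s p" u v q]
    by (simp add: cinner_scale_left cinner_scale_right vector_scalar_commute mult.left_commute mult.assoc)
  note * = nonneg_quadratic_form[OF this]
  from *(1) show "cinner q (\<Phi> (ketbra v u) *v p) = cnj (cinner p (\<Phi> (ketbra u v) *v q))" .
  from *(2) show "cinner p (\<Phi> (ketbra u u) *v p) = 0 \<Longrightarrow> cinner p (\<Phi> (ketbra u v) *v q) = 0" .
qed

lemma completely_positive_adjoint:
  assumes "completely_positive \<Phi>"
  shows "adjoint_mat (\<Phi> (ketbra u v)) = \<Phi> (ketbra v u)"
proof -
  have "cnj (\<Phi> (ketbra u v) $ j $ i) = \<Phi> (ketbra v u) $ i $ j" for i j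
    using completely_positive_hermitian[OF assms, of "axis i 1" v u "axis j 1"]
    by (simp add: cinner_axis_left mult_vec_axis_nth)
  then show ?thesis by (simp add: vec_eq_iff)
qed

section \<open>Outputs for a pure bipartite input\<close>

text \<open>Writing the input as the sum of psi_a tensor |a> over the ancilla basis reduces every
  question about the output to values of \<open>\<Phi>\<close> on the operators
  |psi_a><psi_b|.\<close>

lemma tensor_id_ketbra_nth:
  "tensor_id \<Phi> (ketbra \<psi> \<psi>) $ (i, a) $ (j, b) =
    \<Phi> (ketbra (\<chi> k. \<psi> $ (k, a)) (\<chi> k. \<psi> $ (k, b))) $ i $ j"
  by (simp add: tensor_id_def ketbra_def)

lemma tensor_id_ketbra_hermitian:
  assumes "completely_positive \<Phi>"
  shows "adjoint_mat (tensor_id \<Phi> (ketbra \<psi> \<psi>)) = tensor_id \<Phi> (ketbra \<psi> \<psi>)"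
proof -
  have "cnj (\<Phi> (ketbra u v) $ j $ i) = \<Phi> (ketbra v u) $ i $ j" for u v i j
    using completely_positive_adjoint[OF assms, of u v] by (simp add: vec_eq_iff)
  then show ?thesis by (simp add: vec_eq_iff tensor_id_ketbra_nth)
qed

lemma trace_tensor_id_ketbra:
  fixes \<psi> :: "complex^('n::finite \<times> 'm::finite)"
  assumes "\<And>X. trace (\<Phi> X) = trace X"
  shows "trace (tensor_id \<Phi> (ketbra \<psi> \<psi>)) = of_real ((norm \<psi>)\<^sup>2)"
proof -
  have "trace (tensor_id \<Phi> (ketbra \<psi> \<psi>)) =
      (\<Sum>i\<in>UNIV. \<Sum>a\<in>UNIV. tensor_id \<Phi> (ketbra \<psi> \<psi>) $ (i, a) $ (i, a))"
    unfolding trace_def sum.cartesian_product by (simp add: case_prod_unfold)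
  also have "\<dots> = (\<Sum>a\<in>UNIV. trace (\<Phi> (ketbra (\<chi> k. \<psi> $ (k, a)) (\<chi> k. \<psi> $ (k, a)))))"
    unfolding tensor_id_ketbra_nth trace_def by (rule sum.swap)
  also have "\<dots> = (\<Sum>a\<in>UNIV. \<Sum>k\<in>UNIV. \<psi> $ (k, a) * cnj (\<psi> $ (k, a)))"
    by (simp add: assms) (simp add: trace_def ketbra_def)
  also have "\<dots> = (\<Sum>k\<in>UNIV. \<Sum>a\<in>UNIV. \<psi> $ (k, a) * cnj (\<psi> $ (k, a)))"
    by (rule sum.swap)
  also have "\<dots> = cinner \<psi> \<psi>"
    unfolding cinner_def sum.cartesian_product by (simp add: case_prod_unfold mult.commute)
  finally show ?thesis by (simp add: cinner_self)
qed

section \<open>Upper bounds\<close>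

text \<open>For \<open>u\<close> in the kernel, <u, A w> = <A u, w> = 0. This supplies explicit
  vectors of the support.\<close>

lemma hermitian_range_op_support:
  assumes "adjoint_mat A = A"
  shows "A *v w \<in> op_support A"
  using cinner_adjoint[of _ A w] assms by (auto simp: op_support_def cinner_def)

text \<open>Nonzero pairwise orthogonal vectors are linearly independent, and the exchange lemma
  compares them with the spanning set.\<close>

lemma orthogonal_family_card_le:
  fixes v :: "'i \<Rightarrow> complex^'k"
  assumes "finite I" "finite S"
    and nz: "\<And>i. i \<in> I \<Longrightarrow> v i \<noteq> 0"
    and orth: "\<And>i j. i \<in> I \<Longrightarrow> j \<in> I \<Longrightarrow> i \<noteq> j \<Longrightarrow> cinner (v i) (v j) = 0"
    and span: "\<And>i. i \<in> I \<Longrightarrow> v i \<in> vec.span S"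
  shows "card I \<le> card S"
proof -
  have inj: "inj_on v I"
    using nz orth by (metis inj_onI cinner_self_eq_0)
  have "vec.independent (v ` I)"
  proof (rule vec.independent_if_scalars_zero)
    fix f x assume 0: "(\<Sum>x\<in>v ` I. f x *s x) = 0" and "x \<in> v ` I"
    then obtain i where i: "i \<in> I" "x = v i" by auto
    have "0 = cinner (v i) (\<Sum>j\<in>I. f (v j) *s v j)"
      using 0 inj by (simp add: sum.reindex cinner_zero_right)
    also have "\<dots> = (\<Sum>j\<in>I. if j = i then f (v i) * cinner (v i) (v i) else 0)"
      unfolding cinner_sum_right
      by (intro sum.cong) (auto simp: cinner_scale_right orth i)
    also have "\<dots> = f x * cinner (v i) (v i)"
      using i \<open>finite I\<close> by simp
    finally show "f x = 0" using nz[OF i(1)] by (simp add: cinner_self_eq_0)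
  qed (use \<open>finite I\<close> in simp)
  then have "card (v ` I) \<le> card S"
    using vec.independent_span_bound[OF \<open>finite S\<close>] span by blast
  with inj show ?thesis by (simp add: card_image)
qed

text \<open>Each output has trace 1, so its range contains a nonzero vector; these vectors lie in
  orthogonal supports. The set \<open>S\<close> is left open: the standard basis serves for the
  bound d^2, and a set of at most d vectors for the identity action.\<close>

lemma distinguishable_le_card_spanning:
  fixes S :: "(complex^('n::finite \<times> 'n)) set"
  assumes ch: "\<And>n. n \<in> {1..M} \<Longrightarrow> quantum_channel (\<Phi> n)" and "finite S" "norm \<psi> = 1"
    and orth: "\<And>m n. m \<in> {1..M} \<Longrightarrow> n \<in> {1..M} \<Longrightarrow> m \<noteq> n \<Longrightarrow>
      orthogonal_supports (tensor_id (\<Phi> m) (ketbra \<psi> \<psi>)) (tensor_id (\<Phi> n) (ketbra \<psi> \<psi>))"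
    and span: "\<And>n w. n \<in> {1..M} \<Longrightarrow> tensor_id (\<Phi> n) (ketbra \<psi> \<psi>) *v w \<in> vec.span S"
  shows "M \<le> card S"
proof -
  define A where "A n = tensor_id (\<Phi> n) (ketbra \<psi> \<psi>)" for n
  have "\<exists>w. A n *v w \<noteq> 0" if "n \<in> {1..M}" for n
  proof (rule ccontr)
    assume "\<nexists>w. A n *v w \<noteq> 0"
    then have "A n = 0" by (simp add: matrix_eq)
    moreover have "trace (A n) = 1"
      using ch[OF that] \<open>norm \<psi> = 1\<close> by (simp add: A_def trace_tensor_id_ketbra quantum_channel_def)
    ultimately show False by (simp add: trace_def)
  qed
  then obtain w where w: "\<And>n. n \<in> {1..M} \<Longrightarrow> A n *v w n \<noteq> 0" by metis
  have supp: "A n *v w n \<in> op_support (A n)" if "n \<in> {1..M}" for n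
    using ch[OF that] unfolding A_def quantum_channel_def
    by (intro hermitian_range_op_support tensor_id_ketbra_hermitian) auto
  have "card {1..M} \<le> card S"
  proof (rule orthogonal_family_card_le[where v = "\<lambda>n. A n *v w n"])
    show "cinner (A m *v w m) (A n *v w n) = 0"
      if "m \<in> {1..M}" "n \<in> {1..M}" "m \<noteq> n" for m n
      using orth[OF that] supp that unfolding A_def orthogonal_supports_def by blast
  qed (use w span \<open>finite S\<close> in \<open>auto simp: A_def\<close>)
  then show ?thesis by simp
qed

lemma distinguishability_number_le_square:
  fixes e :: "'n::finite \<Rightarrow> complex^'n"
  shows "distinguishability_number e T \<le> enat (CARD('n) ^ 2)"
  unfolding distinguishability_number_def
proof (rule Sup_least, clarify)
  fix M and \<Phi> :: "nat \<Rightarrow> complex^'n^'n \<Rightarrow> complex^'n^'n"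
  assume ch: "\<forall>n\<in>{1..M}. quantum_channel (\<Phi> n) \<and> has_classical_action e (\<Phi> n) T"
    and "perfectly_distinguishable M \<Phi>"
  then obtain \<psi> :: "complex^('n \<times> 'n)" where \<psi>: "norm \<psi> = 1"
    "\<forall>m\<in>{1..M}. \<forall>n\<in>{1..M}. m \<noteq> n \<longrightarrow>
      orthogonal_supports (tensor_id (\<Phi> m) (ketbra \<psi> \<psi>)) (tensor_id (\<Phi> n) (ketbra \<psi> \<psi>))"
    unfolding perfectly_distinguishable_def by blast
  have "M \<le> card (cart_basis :: (complex^('n \<times> 'n)) set)"
    by (rule distinguishable_le_card_spanning[where \<Phi> = \<Phi> and \<psi> = \<psi>])
       (use ch \<psi> in \<open>auto simp: finite_cart_basis span_cart_basis\<close>)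
  then show "enat M \<le> enat (CARD('n) ^ 2)"
    by (simp add: card_cart_basis power2_eq_square)
qed

section \<open>Expansion in the basis \<open>e\<close>, and the upper bound for the identity
  action\<close>

definition basis_mat :: "('n::finite \<Rightarrow> complex^'n) \<Rightarrow> complex^'n^'n" where
  "basis_mat e = (\<chi> i k. e k $ i)"

lemma basis_mat_unitary:
  assumes "orthonormal_basis e"
  shows "adjoint_mat (basis_mat e) ** basis_mat e = mat 1"
    and "basis_mat e ** adjoint_mat (basis_mat e) = mat 1"
proof -
  show "adjoint_mat (basis_mat e) ** basis_mat e = mat 1"
    using assms
    by (simp add: basis_mat_def matrix_matrix_mult_def vec_eq_iff mat_def orthonormal_basis_def cinner_def)
  then show "basis_mat e ** adjoint_mat (basis_mat e) = mat 1"
    by (simp add: matrix_left_right_inverse)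
qed

lemma orthonormal_basis_expansion:
  fixes e :: "'n::finite \<Rightarrow> complex^'n"
  assumes "orthonormal_basis e"
  shows "w = (\<Sum>k\<in>UNIV. cinner (e k) w *s e k)"
proof -
  have "w = basis_mat e *v (adjoint_mat (basis_mat e) *v w)"
    by (simp add: matrix_vector_mul_assoc basis_mat_unitary assms)
  also have "\<dots> = (\<Sum>k\<in>UNIV. cinner (e k) w *s e k)"
    by (simp add: vec_eq_iff matrix_vector_mult_def basis_mat_def cinner_def mult.commute)
  finally show ?thesis .
qed

lemma ketbra_sum_left: "ketbra (\<Sum>k\<in>K. c k *s u k) v = (\<Sum>k\<in>K. mscale (c k) (ketbra (u k) v))"
  by (simp add: vec_eq_iff ketbra_def mscale_def sum_distrib_right mult.assoc)

text \<open>The k-th spanning vector is \<open>e k\<close> tensor psi_k, where the input is the sum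
  of these products over k. Since <e i|Phi(|e k><e k|)|e i> = 0 for i different from k, positivity
  confines the range of Phi(|e k><v|) to the line through \<open>e k\<close>, for every
  \<open>v\<close>.\<close>

lemma channel_identity_action_range:
  fixes e :: "'n::finite \<Rightarrow> complex^'n"
  assumes e: "orthonormal_basis e" and ch: "quantum_channel \<Phi>"
    and act: "has_classical_action e \<Phi> (mat 1)"
  shows "tensor_id \<Phi> (ketbra \<psi> \<psi>) *v w \<in>
    vec.span (range (\<lambda>k. \<chi> p. e k $ fst p * cinner (e k) (\<chi> i. \<psi> $ (i, snd p))))"
    (is "_ \<in> vec.span (range ?s)")
proof -
  interpret \<Phi>: Vector_Spaces.linear mscale mscale \<Phi>
    using ch by (simp add: quantum_channel_def)
  have cp: "completely_positive \<Phi>" using ch by (simp add: quantum_channel_def)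
  define \<psi>' where "\<psi>' a = (\<chi> i. \<psi> $ (i, a))" for a
  have "cinner (e i) (\<Phi> (ketbra (e k) v) *v q) = 0" if "i \<noteq> k" for i k v q
  proof (rule completely_positive_null[OF cp])
    have "complex_of_real (mat 1 $ i $ k) = cinner (e i) (\<Phi> (ketbra (e k) (e k)) *v e i)"
      using act unfolding has_classical_action_def by blast
    then show "cinner (e i) (\<Phi> (ketbra (e k) (e k)) *v e i) = 0"
      using that by (simp add: mat_def)
  qed
  then have ek: "\<Phi> (ketbra (e k) v) *v q = cinner (e k) (\<Phi> (ketbra (e k) v) *v q) *s e k" for k v q
    by (subst orthonormal_basis_expansion[OF e, of "\<Phi> (ketbra (e k) v) *v q"],
        subst sum.remove[of _ k]) (auto intro!: sum.neutral)
  have entry: "\<Phi> (ketbra (\<psi>' a) v) $ i $ j =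
      (\<Sum>k\<in>UNIV. cinner (e k) (\<psi>' a) * (cinner (e k) (\<Phi> (ketbra (e k) v) *v axis j 1) * e k $ i))"
    for a v i j
  proof -
    have "\<Phi> (ketbra (\<psi>' a) v) = (\<Sum>k\<in>UNIV. mscale (cinner (e k) (\<psi>' a)) (\<Phi> (ketbra (e k) v)))"
      by (subst orthonormal_basis_expansion[OF e, of "\<psi>' a"])
         (simp add: ketbra_sum_left \<Phi>.sum \<Phi>.scale)
    moreover have "\<Phi> (ketbra (e k) v) $ i $ j =
        cinner (e k) (\<Phi> (ketbra (e k) v) *v axis j 1) * e k $ i" for k
      using arg_cong[OF ek[of k v "axis j 1"], of "\<lambda>x. x $ i"]
      by (simp add: mult_vec_axis_nth)
    ultimately show ?thesis by (simp add: mscale_def)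
  qed
  \<comment> \<open>\<open>c k\<close> collects everything that is independent of the output
    coordinates (i, a), so after exchanging the sums the output is a combination of fixed
    vectors.\<close>
  define c where "c k = (\<Sum>q\<in>UNIV. cinner (e k) (\<Phi> (ketbra (e k) (\<psi>' (snd q))) *v axis (fst q) 1) * w $ q)"
    for k
  have "tensor_id \<Phi> (ketbra \<psi> \<psi>) *v w = (\<Sum>k\<in>UNIV. c k *s ?s k)"
  proof (subst vec_eq_iff, clarify)
    fix i a
    have "(tensor_id \<Phi> (ketbra \<psi> \<psi>) *v w) $ (i, a) =
        (\<Sum>q\<in>UNIV. \<Phi> (ketbra (\<psi>' a) (\<psi>' (snd q))) $ i $ fst q * w $ q)"
      unfolding matrix_vector_mult_def
      by (auto simp: \<psi>'_def tensor_id_def ketbra_def)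
    also have "\<dots> = (\<Sum>q\<in>UNIV. \<Sum>k\<in>UNIV. cinner (e k) (\<psi>' a) *
        (cinner (e k) (\<Phi> (ketbra (e k) (\<psi>' (snd q))) *v axis (fst q) 1) * e k $ i) * w $ q)"
      unfolding entry sum_distrib_right ..
    also have "\<dots> = (\<Sum>k\<in>UNIV. \<Sum>q\<in>UNIV. cinner (e k) (\<psi>' a) *
        (cinner (e k) (\<Phi> (ketbra (e k) (\<psi>' (snd q))) *v axis (fst q) 1) * e k $ i) * w $ q)"
      by (rule sum.swap)
    also have "\<dots> = (\<Sum>k\<in>UNIV. c k *s ?s k) $ (i, a)"
      by (simp add: c_def \<psi>'_def sum_distrib_right sum_distrib_left ac_simps)
    finally show "(tensor_id \<Phi> (ketbra \<psi> \<psi>) *v w) $ (i, a) = (\<Sum>k\<in>UNIV. c k *s ?s k) $ (i, a)" .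
  qed
  then show ?thesis
    by (simp only:) (intro vec.span_sum vec.span_scale vec.span_base rangeI)
qed

lemma distinguishability_number_identity_le:
  fixes e :: "'n::finite \<Rightarrow> complex^'n"
  assumes "orthonormal_basis e"
  shows "distinguishability_number e (mat 1) \<le> enat CARD('n)"
  unfolding distinguishability_number_def
proof (rule Sup_least, clarify)
  fix M and \<Phi> :: "nat \<Rightarrow> complex^'n^'n \<Rightarrow> complex^'n^'n"
  assume ch: "\<forall>n\<in>{1..M}. quantum_channel (\<Phi> n) \<and> has_classical_action e (\<Phi> n) (mat 1)"
    and "perfectly_distinguishable M \<Phi>"
  then obtain \<psi> :: "complex^('n \<times> 'n)" where \<psi>: "norm \<psi> = 1"
    "\<forall>m\<in>{1..M}. \<forall>n\<in>{1..M}. m \<noteq> n \<longrightarrow>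
      orthogonal_supports (tensor_id (\<Phi> m) (ketbra \<psi> \<psi>)) (tensor_id (\<Phi> n) (ketbra \<psi> \<psi>))"
    unfolding perfectly_distinguishable_def by blast
  define s :: "'n \<Rightarrow> complex^('n \<times> 'n)"
    where "s k = (\<chi> p. e k $ fst p * cinner (e k) (\<chi> i. \<psi> $ (i, snd p)))" for k
  have "M \<le> card (range s)"
  proof (rule distinguishable_le_card_spanning[where \<Phi> = \<Phi> and \<psi> = \<psi>])
    show "tensor_id (\<Phi> n) (ketbra \<psi> \<psi>) *v w \<in> vec.span (range s)" if "n \<in> {1..M}" for n w
      unfolding s_def using ch that by (intro channel_identity_action_range[OF assms]) auto
  qed (use ch \<psi> in auto)
  \<comment> \<open>Only an inequality: the vectors \<open>s k\<close> may coincide, for instance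
    when several of them are zero.\<close>
  also have "\<dots> \<le> CARD('n)" by (rule card_image_le) simp
  finally show "enat M \<le> enat CARD('n)" by simp
qed

section \<open>Unitary channels\<close>

definition conj_map :: "complex^'n^'n \<Rightarrow> complex^'n^'n \<Rightarrow> complex^'n^'n" where
  "conj_map U X = U ** X ** adjoint_mat U"

lemma conj_map_ketbra: "conj_map U (ketbra u v) = ketbra (U *v u) (U *v v)"
  unfolding conj_map_def matrix_eq
  by (simp add: matrix_vector_mul_assoc[symmetric] ketbra_mult_vec vector_scalar_commute)
     (simp add: cinner_adjoint)

text \<open>Testing the conjugated block matrix on \<open>v\<close> is testing the original one on
  the vectors \<open>adjoint_mat U *v v a\<close>, so positivity carries over. The trace is
  preserved because it is cyclic.\<close>

lemma quantum_channel_conj_map: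
  fixes U :: "complex^'n^'n"
  assumes "adjoint_mat U ** U = mat 1"
  shows "quantum_channel (conj_map U)"
  unfolding quantum_channel_def
proof (intro conjI allI)
  show "Vector_Spaces.linear mscale mscale (conj_map U)"
    by unfold_locales
       (simp_all add: conj_map_def mscale_def vec_eq_iff matrix_matrix_mult_def algebra_simps
         sum_distrib_left sum.distrib sum_distrib_right)
  show "completely_positive (conj_map U)"
    unfolding completely_positive_def block_psd_def
  proof clarify
    fix k v and X :: "nat \<Rightarrow> nat \<Rightarrow> complex^'n^'n"
    assume X: "\<forall>v. (\<Sum>a<k. \<Sum>b<k. cinner (v a) (X a b *v v b)) \<in> \<real>\<^sub>\<ge>\<^sub>0"
    have "cinner (v a) (conj_map U (X a b) *v v b) =
        cinner (adjoint_mat U *v v a) (X a b *v (adjoint_mat U *v v b))" for a b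
      by (simp add: conj_map_def matrix_vector_mul_assoc[symmetric] cinner_adjoint[of _ U])
    then show "(\<Sum>a<k. \<Sum>b<k. cinner (v a) (conj_map U (X a b) *v v b)) \<in> \<real>\<^sub>\<ge>\<^sub>0"
      using spec[OF X, of "\<lambda>a. adjoint_mat U *v v a"] by simp
  qed
  show "trace (conj_map U X) = trace X" for X
    unfolding conj_map_def
    by (subst trace_mul_sym) (simp add: matrix_mul_assoc assms)
qed

text \<open>As \<open>y\<close> is in the kernel of |x><x|, a vector \<open>u\<close> of the first
  support is orthogonal to \<open>y\<close>. Hence \<open>u\<close> is in the kernel of |y><y| and
  orthogonal to the second support.\<close>

lemma orthogonal_supports_ketbra:
  assumes "cinner x y = 0"
  shows "orthogonal_supports (ketbra x x) (ketbra y y)"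
  unfolding orthogonal_supports_def op_support_def
proof clarify
  fix u v
  assume u: "\<forall>w. ketbra x x *v w = 0 \<longrightarrow> cinner w u = 0"
    and v: "\<forall>w. ketbra y y *v w = 0 \<longrightarrow> cinner w v = 0"
  have "cinner y u = 0"
    using u assms by (simp add: ketbra_mult_vec)
  with v show "cinner u v = 0" by (simp add: ketbra_mult_vec)
qed

text \<open>On the maximally entangled state a unitary channel outputs the projector onto its
  vectorised matrix, and the inner product of two such vectors is the Hilbert-Schmidt product
  divided by d.\<close>

lemma perfectly_distinguishable_unitaries:
  fixes U :: "nat \<Rightarrow> complex^'n^'n"
  assumes "\<And>m n. m \<in> {1..M} \<Longrightarrow> n \<in> {1..M} \<Longrightarrow> m \<noteq> n \<Longrightarrow> trace (adjoint_mat (U m) ** U n) = 0"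
  shows "perfectly_distinguishable M (\<lambda>n. conj_map (U n))"
proof -
  \<comment> \<open>\<open>r\<close> normalises the maximally entangled state \<open>\<psi>\<close>;
    \<open>\<phi> n\<close> is the vectorisation of \<open>U n\<close>, scaled by
    \<open>r\<close>.\<close>
  define r where "r = complex_of_real (1 / sqrt (real CARD('n)))"
  define \<psi> :: "complex^('n \<times> 'n)" where "\<psi> = (\<chi> p. if fst p = snd p then r else 0)"
  define \<phi> :: "nat \<Rightarrow> complex^('n \<times> 'n)" where "\<phi> n = (\<chi> p. U n $ fst p $ snd p * r)" for n
  have "cinner \<psi> \<psi> = (\<Sum>i::'n\<in>UNIV. \<Sum>a::'n\<in>UNIV. if i = a then cnj r * r else 0)"
    unfolding cinner_def sum.cartesian_product \<psi>_def
    by (auto intro!: sum.cong)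
  also have "\<dots> = of_nat CARD('n) * (cnj r * r)" by simp
  also have "cnj r * r = 1 / of_nat CARD('n)"
    by (simp add: r_def flip: of_real_mult)
  finally have "(norm \<psi>)\<^sup>2 = 1"
    by (simp add: cinner_self del: of_real_power)
  then have "norm \<psi> = 1"
    by (metis norm_ge_zero power2_eq_1_iff neg_0_le_iff_le not_one_le_zero)
  have out: "tensor_id (conj_map (U n)) (ketbra \<psi> \<psi>) = ketbra (\<phi> n) (\<phi> n)" for n
  proof -
    have "(U n *v (\<chi> i. \<psi> $ (i, a))) $ i = \<phi> n $ (i, a)" for i a
      by (simp add: matrix_vector_mult_def \<psi>_def \<phi>_def if_distrib[of "\<lambda>x. _ * x"] cong: if_cong)
    then show ?thesis
      by (simp add: vec_eq_iff tensor_id_ketbra_nth conj_map_ketbra) (simp add: ketbra_def)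
  qed
  have "cinner (\<phi> m) (\<phi> n) = 0" if "m \<in> {1..M}" "n \<in> {1..M}" "m \<noteq> n" for m n
  proof -
    have "cinner (\<phi> m) (\<phi> n) =
        (\<Sum>i\<in>UNIV. \<Sum>a\<in>UNIV. cnj r * r * (cnj (U m $ i $ a) * U n $ i $ a))"
      unfolding cinner_def sum.cartesian_product \<phi>_def
      by (auto intro!: sum.cong simp: ac_simps)
    also have "\<dots> = (\<Sum>a\<in>UNIV. \<Sum>i\<in>UNIV. cnj r * r * (cnj (U m $ i $ a) * U n $ i $ a))"
      by (rule sum.swap)
    also have "\<dots> = cnj r * r * trace (adjoint_mat (U m) ** U n)"
      by (simp add: trace_def matrix_matrix_mult_def sum_distrib_left)
    finally show ?thesis using assms[OF that] by simp
  qed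
  with \<open>norm \<psi> = 1\<close> show ?thesis
    unfolding perfectly_distinguishable_def
    by (intro exI[of _ \<psi>]) (simp add: out orthogonal_supports_ketbra)
qed

text \<open>The \<open>U n\<close> are matrices relative to \<open>e\<close>; the channels conjugate
  by the operators \<open>V n\<close> that they represent. This change of basis keeps unitarity and
  Hilbert-Schmidt products, and the classical action of \<open>V n\<close> consists of the squared
  moduli of the entries of \<open>U n\<close>.\<close>

lemma distinguishability_number_ge_unitaries:
  fixes e :: "'n::finite \<Rightarrow> complex^'n" and U :: "nat \<Rightarrow> complex^'n^'n"
  assumes e: "orthonormal_basis e"
    and unitary: "\<And>n. n \<in> {1..M} \<Longrightarrow> adjoint_mat (U n) ** U n = mat 1"
    and orth: "\<And>m n. m \<in> {1..M} \<Longrightarrow> n \<in> {1..M} \<Longrightarrow> m \<noteq> n \<Longrightarrow> trace (adjoint_mat (U m) ** U n) = 0"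
    and T: "\<And>n k l. n \<in> {1..M} \<Longrightarrow> (cmod (U n $ k $ l))\<^sup>2 = T $ k $ l"
  shows "enat M \<le> distinguishability_number e T"
proof -
  define E where "E = basis_mat e"
  have E: "adjoint_mat E ** E = mat 1" "E ** adjoint_mat E = mat 1"
    unfolding E_def using basis_mat_unitary[OF e] by auto
  define V where "V n = E ** U n ** adjoint_mat E" for n
  have VV: "adjoint_mat (V m) ** V n = E ** (adjoint_mat (U m) ** U n) ** adjoint_mat E" for m n
  proof -
    have "adjoint_mat (V m) ** V n =
        E ** adjoint_mat (U m) ** (adjoint_mat E ** E) ** U n ** adjoint_mat E"
      by (simp add: V_def adjoint_mat_mult matrix_mul_assoc)
    then show ?thesis by (simp add: E matrix_mul_assoc)
  qed
  have e_axis: "e k = E *v axis k 1" for k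
    by (simp add: E_def vec_eq_iff mult_vec_axis_nth basis_mat_def)
  have Ve: "cinner (e k) (V n *v e l) = U n $ k $ l" for n k l
  proof -
    have "cinner (e k) (V n *v e l) =
        cinner (axis k 1) ((adjoint_mat E ** E) *v (U n *v ((adjoint_mat E ** E) *v axis l 1)))"
      unfolding V_def e_axis
      by (simp add: matrix_vector_mul_assoc[symmetric]) (simp add: cinner_adjoint)
    then show ?thesis
      by (simp add: E cinner_axis_left mult_vec_axis_nth)
  qed
  have "has_classical_action e (conj_map (V n)) T" if "n \<in> {1..M}" for n
    unfolding has_classical_action_def conj_map_ketbra ketbra_mult_vec cinner_scale_right Ve
    using T[OF that, symmetric] Ve[symmetric] cnj_cinner[of "e _" "V n *v e _"]
    by (simp add: complex_norm_square mult.commute del: of_real_power)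
  moreover have "quantum_channel (conj_map (V n))" if "n \<in> {1..M}" for n
    by (rule quantum_channel_conj_map) (simp add: VV unitary[OF that] E)
  moreover have "perfectly_distinguishable M (\<lambda>n. conj_map (V n))"
  proof (rule perfectly_distinguishable_unitaries)
    fix m n assume "m \<in> {1..M}" "n \<in> {1..M}" "m \<noteq> n"
    then show "trace (adjoint_mat (V m) ** V n) = 0"
      unfolding VV by (subst trace_mul_sym) (simp add: matrix_mul_assoc E orth)
  qed
  ultimately show ?thesis
    unfolding distinguishability_number_def
    by (intro Sup_upper) (auto intro!: exI[of _ "\<lambda>n. conj_map (V n)"])
qed

section \<open>Unitaries from roots of unity\<close>

text \<open>A geometric sum with ratio \<open>z\<close> = omega^x, where omega = exp(2 pi i/d) and
  z^d = 1. The ratio is 1 only if d divides \<open>x\<close>, which the bound on \<open>x\<close>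
  restricts to \<open>x = 0\<close>.\<close>

lemma sum_cis_root:
  fixes x :: int and d :: nat
  assumes "\<bar>x\<bar> < int d"
  shows "(\<Sum>k<d. cis (2 * pi * of_int x * real k / real d)) = (if x = 0 then of_nat d else 0)"
proof (cases "x = 0")
  case False
  define z where "z = cis (2 * pi * of_int x / real d)"
  have "d > 0" using assms by linarith
  have "z \<noteq> 1"
  proof
    assume "z = 1"
    then have "cos (2 * pi * of_int x / real d) = 1"
      by (simp add: z_def complex_eq_iff)
    then obtain n :: int where "2 * pi * of_int x / real d = of_int n * 2 * pi"
      using cos_one_2pi_int by blast
    then have "of_int x = (of_int (n * int d) :: real)"
      using \<open>d > 0\<close> by (simp add: field_simps)
    then have "x = n * int d" by (simp only: of_int_eq_iff)
    with assms False show False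
      by (metis abs_mult abs_of_nat dvd_triv_right zdvd_not_zless zero_less_abs_iff dvd_abs_iff)
  qed
  have "(\<Sum>k<d. cis (2 * pi * of_int x * real k / real d)) = (\<Sum>k<d. z ^ k)"
    by (simp add: z_def Complex.DeMoivre mult_ac)
  also have "\<dots> = (z ^ d - 1) / (z - 1)"
    using \<open>z \<noteq> 1\<close> by (rule geometric_sum)
  also have "z ^ d = 1"
    using \<open>d > 0\<close> cis_multiple_2pi[of "of_int x"]
    by (simp add: z_def Complex.DeMoivre mult_ac)
  finally show ?thesis using False by simp
qed simp

text \<open>The index type carries no arithmetic, so \<open>h\<close> numbers its elements by 0,
  ..., d-1 to make them usable in exponents. The values are integers so that their differences may
  be negative.\<close>

lemma ex_index_sum_cis:
  obtains h :: "'n::finite \<Rightarrow> int"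
  where "inj h" and "\<And>k. 0 \<le> h k" and "\<And>k. h k < int CARD('n)"
    and "\<And>x::int. \<bar>x\<bar> < int CARD('n) \<Longrightarrow>
      (\<Sum>k\<in>UNIV. cis (2 * pi * of_int (x * h k) / real CARD('n))) = (if x = 0 then of_nat CARD('n) else 0)"
proof -
  obtain g :: "'n \<Rightarrow> nat" where g: "bij_betw g UNIV {..<CARD('n)}"
    using ex_bij_betw_finite_nat[of "UNIV :: 'n set"] by (auto simp: atLeast0LessThan)
  show thesis
  proof
    show "inj (\<lambda>k. int (g k))"
      using bij_betw_imp_inj_on[OF g] by (auto simp: inj_on_def)
    show "int (g k) < int CARD('n)" for k
      using bij_betwE[OF g] by auto
    show "(\<Sum>k\<in>UNIV. cis (2 * pi * of_int (x * int (g k)) / real CARD('n))) =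
      (if x = 0 then of_nat CARD('n) else 0)" if "\<bar>x\<bar> < int CARD('n)" for x :: int
      using sum_cis_root[OF that]
        sum.reindex_bij_betw[OF g, of "\<lambda>k. cis (2 * pi * of_int x * real k / real CARD('n))"]
      by (simp add: mult_ac)
  qed simp
qed

section \<open>Lower bounds from explicit families of unitaries\<close>

text \<open>The \<open>U n\<close> are powers of the clock matrix diag(omega^k). The trace for the
  pair \<open>m\<close>, \<open>n\<close> is the character sum at \<open>x\<close> = n - m, which
  vanishes since 0 < |n - m| < d.\<close>

lemma distinguishability_number_identity_ge:
  fixes e :: "'n::finite \<Rightarrow> complex^'n"
  assumes "orthonormal_basis e"
  shows "enat CARD('n) \<le> distinguishability_number e (mat 1)"
proof -
  obtain h :: "'n \<Rightarrow> int"
    where sum_h: "\<And>x::int. \<bar>x\<bar> < int CARD('n) \<Longrightarrow>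
      (\<Sum>k\<in>UNIV. cis (2 * pi * of_int (x * h k) / real CARD('n))) = (if x = 0 then of_nat CARD('n) else 0)"
    using ex_index_sum_cis[where 'n = 'n] by metis
  define z where "z x = cis (2 * pi * of_int x / real CARD('n))" for x :: int
  have z_mult: "cnj (z x) * z y = z (y - x)" for x y
    by (simp add: z_def cis_cnj cis_mult diff_divide_distrib algebra_simps)
  have z_0: "z 0 = 1" by (simp add: z_def)
  define U :: "nat \<Rightarrow> complex^'n^'n"
    where "U n = (\<chi> k l. if k = l then z (int n * h k) else 0)" for n
  have UU: "adjoint_mat (U m) ** U n = (\<chi> k l. if k = l then z ((int n - int m) * h k) else 0)" for m n
  proof -
    have "(\<Sum>j\<in>UNIV. cnj (U m $ j $ k) * U n $ j $ l) =
        (\<Sum>j\<in>UNIV. if j = k then (if k = l then z ((int n - int m) * h k) else 0) else 0)" for k l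
      by (intro sum.cong) (auto simp: U_def z_mult left_diff_distrib)
    then show ?thesis by (simp add: vec_eq_iff matrix_matrix_mult_def)
  qed
  show ?thesis
  proof (rule distinguishability_number_ge_unitaries[OF assms])
    show "adjoint_mat (U n) ** U n = mat 1" for n
      by (simp add: UU vec_eq_iff mat_def z_0)
    show "trace (adjoint_mat (U m) ** U n) = 0"
      if "m \<in> {1..CARD('n)}" "n \<in> {1..CARD('n)}" "m \<noteq> n" for m n
    proof -
      have "\<bar>int n - int m\<bar> < int CARD('n)" using that by auto
      from sum_h[OF this] that show ?thesis by (simp add: UU trace_def z_def)
    qed
    show "(cmod (U n $ k $ l))\<^sup>2 = mat 1 $ k $ l" for n k l
      by (simp add: U_def mat_def z_def)
  qed
qed

text \<open>The unitaries are Z^a F Z^b with the Fourier matrix F and the clock matrix Z: the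
  diagonal phases leave all moduli at 1/sqrt d, and the d^2 pairs (a, b) give orthogonal
  matrices.\<close>

lemma distinguishability_number_van_der_waerden_ge:
  fixes e :: "'n::finite \<Rightarrow> complex^'n"
  assumes "orthonormal_basis e"
  shows "enat (CARD('n) ^ 2) \<le> distinguishability_number e van_der_waerden"
proof -
  let ?d = "CARD('n)"
  obtain h :: "'n \<Rightarrow> int"
    where h: "inj h" "\<And>k. 0 \<le> h k" "\<And>k. h k < int ?d"
      and sum_h: "\<And>x::int. \<bar>x\<bar> < int ?d \<Longrightarrow>
        (\<Sum>k\<in>UNIV. cis (2 * pi * of_int (x * h k) / real ?d)) = (if x = 0 then of_nat ?d else 0)"
    using ex_index_sum_cis[where 'n = 'n] by metis
  define z where "z x = cis (2 * pi * of_int x / real ?d)" for x :: int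
  have z_mult: "cnj (z x) * z y = z (y - x)" for x y
    by (simp add: z_def cis_cnj cis_mult diff_divide_distrib algebra_simps)
  have z_add: "z (x + y) = z x * z y" for x y
    by (simp add: z_def cis_mult add_divide_distrib algebra_simps)
  have z_0: "z 0 = 1" by (simp add: z_def)
  have sum_z: "(\<Sum>k\<in>UNIV. z (x * h k)) = (if x = 0 then of_nat ?d else 0)" if "\<bar>x\<bar> < int ?d" for x
    using sum_h[OF that] by (simp add: z_def)
  define r where "r = complex_of_real (1 / sqrt (real ?d))"
  have r: "cnj r * r = 1 / of_nat ?d"
    by (simp add: r_def flip: of_real_mult)
  \<comment> \<open>The base-d digits of n - 1, for \<open>n\<close> from 1 to d^2, run through all
    pairs (a, b) with entries below d.\<close>
  define a where "a n = int ((n - 1) mod ?d)" for n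
  define b where "b n = int ((n - 1) div ?d)" for n
  define U :: "nat \<Rightarrow> complex^'n^'n"
    where "U n = (\<chi> k l. r * z (a n * h k + h k * h l + b n * h l))" for n
  \<comment> \<open>The exponent is split so that the summation index \<open>j\<close> of the matrix
    product occurs in one factor only, whose sum is a character sum.\<close>
  have U_mult: "cnj (U m $ j $ k) * U n $ j $ l =
      z ((b n * h l) - (b m * h k)) / of_nat ?d * z ((a n - a m + h l - h k) * h j)" for m n j k l
  proof -
    have "cnj (U m $ j $ k) * U n $ j $ l = (cnj r * r) *
        (cnj (z (a m * h j + h j * h k + b m * h k)) * z (a n * h j + h j * h l + b n * h l))"
      by (simp add: U_def mult_ac)
    also have "\<dots> = 1 / of_nat ?d * z (((b n * h l) - (b m * h k)) + (a n - a m + h l - h k) * h j)"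
      unfolding r z_mult by (simp add: algebra_simps)
    finally show ?thesis by (simp add: z_add)
  qed
  have UU: "(adjoint_mat (U m) ** U n) $ k $ l =
      z ((b n * h l) - (b m * h k)) / of_nat ?d * (\<Sum>j\<in>UNIV. z ((a n - a m + h l - h k) * h j))" for m n k l
    by (simp add: matrix_matrix_mult_def U_mult sum_distrib_left)
  show ?thesis
  proof (rule distinguishability_number_ge_unitaries[OF assms])
    show "adjoint_mat (U n) ** U n = mat 1" for n
    proof -
      \<comment> \<open>For equal indices the character sum is taken at \<open>h l - h k\<close>; by
        injectivity of \<open>h\<close> this is zero only on the diagonal.\<close>
      have "\<bar>h l - h k\<bar> < int ?d" for k l
        using h(2)[of k] h(2)[of l] h(3)[of k] h(3)[of l] by linarith
      then show ?thesis
        using h(1) by (auto simp: vec_eq_iff UU mat_def sum_z z_0 inj_eq)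
    qed
    show "trace (adjoint_mat (U m) ** U n) = 0"
      if m: "m \<in> {1..?d ^ 2}" and n: "n \<in> {1..?d ^ 2}" and "m \<noteq> n" for m n
    proof -
      have "a i < int ?d" "0 \<le> a i" for i by (simp_all add: a_def)
      then have a: "\<bar>a n - a m\<bar> < int ?d" by (smt (verit))
      have "b i < int ?d" "0 \<le> b i" if "i \<in> {1..?d ^ 2}" for i
        using that by (auto simp: b_def div_less_iff_less_mult power2_eq_square)
      with m n have b: "\<bar>b n - b m\<bar> < int ?d" by (smt (verit))
      have "a n \<noteq> a m \<or> b n \<noteq> b m"
      proof (rule ccontr)
        assume "\<not> (a n \<noteq> a m \<or> b n \<noteq> b m)"
        then have "n - 1 = m - 1"
          unfolding a_def b_def by (metis div_mult_mod_eq of_nat_eq_iff)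
        with m n \<open>m \<noteq> n\<close> show False by auto
      qed
      then have "(\<Sum>j\<in>UNIV. z ((a n - a m) * h j)) = 0 \<or> (\<Sum>k\<in>UNIV. z ((b n - b m) * h k)) = 0"
        using sum_z[OF a] sum_z[OF b] by auto
      \<comment> \<open>On the diagonal \<open>h l - h k\<close> cancels and the sum over
        \<open>j\<close> no longer depends on \<open>k\<close>. The trace thus factors into two
        character sums, one for each digit, and a digit that differs makes its factor
        vanish.\<close>
      moreover have "(adjoint_mat (U m) ** U n) $ k $ k =
          z ((b n - b m) * h k) / of_nat ?d * (\<Sum>j\<in>UNIV. z ((a n - a m) * h j))" for k
        by (simp add: UU left_diff_distrib)
      then have "trace (adjoint_mat (U m) ** U n) =
          (\<Sum>k\<in>UNIV. z ((b n - b m) * h k)) / of_nat ?d * (\<Sum>j\<in>UNIV. z ((a n - a m) * h j))"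
        by (simp only: trace_def sum_divide_distrib sum_distrib_right)
      ultimately show ?thesis by auto
    qed
    show "(cmod (U n $ k $ l))\<^sup>2 = van_der_waerden $ k $ l" for n k l
      by (simp add: U_def van_der_waerden_def z_def r_def norm_mult norm_divide power_divide)
  qed
qed

theorem proposition17:
  fixes e :: "'n::finite \<Rightarrow> complex^'n"
  assumes "orthonormal_basis e"
  shows "distinguishability_number e (mat 1) = enat CARD('n) \<and>
         distinguishability_number e van_der_waerden = enat (CARD('n) ^ 2)"
  using assms
  by (simp add: antisym distinguishability_number_identity_le distinguishability_number_identity_ge
      distinguishability_number_le_square distinguishability_number_van_der_waerden_ge)

end
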